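(* Let $N\ge 1$ and let $\phi^{(N)}=(\phi_1,\dots,\phi_N)$ be any sequence of monotone likelihood ratio tests based on the least favorable distributions $(Q_0^{(N)},Q_1^{(N)})$ for a tandem network of $N$ agents. Then for all $(P_0^{(N)},P_1^{(N)})\in\mathcal{P}_0^{(N)}\times\mathcal{P}_1^{(N)}$, $$P_{F,N}(\phi^{(N)},Q_0^{(N)})\ \ge\ P_{F,N}(\phi^{(N)},P_0^{(N)})$$ and $$P_{M,N}(\phi^{(N)},Q_1^{(N)})\ \ge\ P_{M,N}(\phi^{(N)},P_1^{(N)}).$$
   Context: Tandem network: agents $1,\dots,N$; the true hypothesis $H$ is $H_i$ with prior probability $\pi_i\in(0,1)$, $i=0,1$, $\pi_0+\pi_1=1$. Conditioned on $H=H_i$, agent $k$ observes $Y_k$ in a measurable space $(\mathcal{Y},\mathcal{A})$ with (unknown) distribution $P_{i,k}$ in the uncertainty class $\mathcal{P}_{i,k}=\{(1-\epsilon_{i,k})P_i^*+\epsilon_{i,k}R : R\in\mathcal{R}\}$, where $\mathcal{R}$ is the set of all probability measures on $(\mathcal{Y},\mathcal{A})$, $P_i^*\in\mathcal{R}$ is the nominal distribution (the same for all agents), and the contamination $\epsilon_{i,k}\in[0,1)$ is small enough that $\mathcal{P}_{0,k}$ and $\mathcal{P}_{1,k}$ are disjoint. All distributions in $\mathcal{P}_{0,k}$ and $\mathcal{P}_{1,k}$ are assumed absolutely continuous with respect to one another. Given $H$, the observations are independent across agents. Agent $k$ decides $U_k=\phi_k(Y_k,U_{k-1})\in\{0,1\}$,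 with $U_0\equiv 0$. $\mathcal{P}_i^{(N)}=\mathcal{P}_{i,1}\times\cdots\times\mathcal{P}_{i,N}$; an element $P_i^{(N)}=P_{i,1}\times\cdots\times P_{i,N}$ is the product law of $(Y_1,\dots,Y_N)$ under $H_i$. $P_{F,N}(\phi^{(N)},P_0^{(N)})=P_0^{(N)}(U_N=1)$ and $P_{M,N}(\phi^{(N)},P_1^{(N)})=P_1^{(N)}(U_N=0)$ are the false alarm and missed detection probabilities of agent $N$. Least favorable distributions (LFDs) $(Q_{0,k},Q_{1,k})$ of $(\mathcal{P}_{0,k},\mathcal{P}_{1,k})$: with $p_i^*$ the density of $P_i^*$ with respect to a common measure, they have densities $q_{0,k}=(1-\epsilon_{0,k})p_0^*$ where $p_1^*/p_0^*<c''$ and $q_{0,k}=(1-\epsilon_{0,k})p_1^*/c''$ where $p_1^*/p_0^*\ge c''$; $q_{1,k}=(1-\epsilon_{1,k})p_1^*$ where $p_1^*/p_0^*>c'$ and $q_{1,k}=c'(1-\epsilon_{1,k})p_0^*$ where $p_1^*/p_0^*\le c'$, where $0\le c'<c''\le\infty$ (depending on $k$) are determined so that $q_{0,k},q_{1,k}$ are probability densities ($c'=0$ iff $\epsilon_{1,k}=0$; $c''=\infty$ iff $\epsilon_{0,k}=0$). $Q_i^{(N)}=Q_{i,1}\times\cdots\times Q_{i,N}$. Monotone likelihood ratio tests based on the LFDs: each agent $k$ uses a threshold $t_k$ and sets $U_k=1$ if $l^*(Y_k,U_{k-1})>t_k$ and $U_k=0$ otherwise, where $l^*(Y_k,U_{k-1})=l^*(Y_k)\,l^*(U_{k-1})$,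 $l^*(Y_k)=q_{1,k}(Y_k)/q_{0,k}(Y_k)$, $l^*(U_{k-1}=u)=Q_1^{(k-1)}(U_{k-1}=u)/Q_0^{(k-1)}(U_{k-1}=u)$ for $k\ge2$, and $l^*(U_0)=1$. *)

theory Defs
  imports "HOL-Probability.Probability"
begin

definition contamination_class :: "'a measure \<Rightarrow> 'a measure \<Rightarrow> real \<Rightarrow> 'a measure set" where
  "contamination_class M Pnom \<epsilon> =
     {P \<in> space (prob_algebra M). \<exists>R \<in> space (prob_algebra M).
        \<forall>A \<in> sets M. measure P A = (1 - \<epsilon>) * measure Pnom A + \<epsilon> * measure R A}"

definition mutually_absolutely_continuous :: "'a measure set \<Rightarrow> bool" where
  "mutually_absolutely_continuous \<P> \<longleftrightarrow> (\<forall>P \<in> \<P>. \<forall>P' \<in> \<P>. absolutely_continuous P P')"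

text \<open>
  Densities of the least favorable distributions, with \<open>p0\<close>, \<open>p1\<close> the nominal densities.
  All quotients are taken in \<^typ>\<open>ennreal\<close>, where \<open>x / 0 = \<infinity>\<close> for \<open>x \<noteq> 0\<close>,
  \<open>x / \<infinity> = 0\<close> and \<open>0 / 0 = 0\<close>.  So \<open>c'' = \<infinity>\<close> needs no separate treatment, and the value of
  \<open>0 / 0\<close> is only relevant on a common null set of the nominal distributions.
\<close>

definition lfd_density0 :: "real \<Rightarrow> ennreal \<Rightarrow> ('a \<Rightarrow> ennreal) \<Rightarrow> ('a \<Rightarrow> ennreal) \<Rightarrow> 'a \<Rightarrow> ennreal" where
  "lfd_density0 \<epsilon>0 c'' p0 p1 y =
     (if p1 y / p0 y < c'' then ennreal (1 - \<epsilon>0) * p0 y else ennreal (1 - \<epsilon>0) * p1 y / c'')"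

definition lfd_density1 :: "real \<Rightarrow> ennreal \<Rightarrow> ('a \<Rightarrow> ennreal) \<Rightarrow> ('a \<Rightarrow> ennreal) \<Rightarrow> 'a \<Rightarrow> ennreal" where
  "lfd_density1 \<epsilon>1 c' p0 p1 y =
     (if p1 y / p0 y > c' then ennreal (1 - \<epsilon>1) * p1 y else c' * ennreal (1 - \<epsilon>1) * p0 y)"

definition lfd_constants ::
  "'a measure \<Rightarrow> ('a \<Rightarrow> ennreal) \<Rightarrow> ('a \<Rightarrow> ennreal) \<Rightarrow> real \<Rightarrow> real \<Rightarrow> ennreal \<Rightarrow> ennreal \<Rightarrow> bool" where
  "lfd_constants \<mu> p0 p1 \<epsilon>0 \<epsilon>1 c' c'' \<longleftrightarrow>
     c' < c'' \<and> (c' = 0 \<longleftrightarrow> \<epsilon>1 = 0) \<and> (c'' = \<infinity> \<longleftrightarrow> \<epsilon>0 = 0) \<and>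
     (\<integral>\<^sup>+ y. lfd_density0 \<epsilon>0 c'' p0 p1 y \<partial>\<mu>) = 1 \<and>
     (\<integral>\<^sup>+ y. lfd_density1 \<epsilon>1 c' p0 p1 y \<partial>\<mu>) = 1"

text \<open>
  Decision rules \<open>\<phi> k\<close> map an observation and the preceding decision to a decision; decisions
  are the numbers 0 and 1.  Agents are numbered from 1, and the observation of agent \<open>k\<close> is \<open>y k\<close>.
\<close>

fun tandem_decision :: "(nat \<Rightarrow> 'a \<Rightarrow> nat \<Rightarrow> nat) \<Rightarrow> nat \<Rightarrow> (nat \<Rightarrow> 'a) \<Rightarrow> nat" where
  "tandem_decision \<phi> 0 y = 0"
| "tandem_decision \<phi> (Suc k) y = \<phi> (Suc k) (y (Suc k)) (tandem_decision \<phi> k y)"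

definition product_law :: "nat \<Rightarrow> (nat \<Rightarrow> 'a measure) \<Rightarrow> (nat \<Rightarrow> 'a) measure" where
  "product_law k P = PiM {1..k} P"

definition decision_prob :: "(nat \<Rightarrow> 'a \<Rightarrow> nat \<Rightarrow> nat) \<Rightarrow> nat \<Rightarrow> (nat \<Rightarrow> 'a measure) \<Rightarrow> nat \<Rightarrow> real" where
  "decision_prob \<phi> k P u =
     measure (product_law k P) {y \<in> space (product_law k P). tandem_decision \<phi> k y = u}"

definition false_alarm_prob :: "(nat \<Rightarrow> 'a \<Rightarrow> nat \<Rightarrow> nat) \<Rightarrow> nat \<Rightarrow> (nat \<Rightarrow> 'a measure) \<Rightarrow> real" where
  "false_alarm_prob \<phi> N P0 = decision_prob \<phi> N P0 1"

definition missed_detection_prob :: "(nat \<Rightarrow> 'a \<Rightarrow> nat \<Rightarrow> nat) \<Rightarrow> nat \<Rightarrow> (nat \<Rightarrow> 'a measure) \<Rightarrow> real" where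
  "missed_detection_prob \<phi> N P1 = decision_prob \<phi> N P1 0"

definition decision_lr ::
  "(nat \<Rightarrow> 'a \<Rightarrow> nat \<Rightarrow> nat) \<Rightarrow> (nat \<Rightarrow> 'a measure) \<Rightarrow> (nat \<Rightarrow> 'a measure) \<Rightarrow> nat \<Rightarrow> nat \<Rightarrow> ennreal" where
  "decision_lr \<phi> Q0 Q1 k u =
     (if k = 0 then 1 else ennreal (decision_prob \<phi> k Q1 u) / ennreal (decision_prob \<phi> k Q0 u))"

text \<open>
  The condition on \<open>\<phi> k\<close> refers to \<open>\<phi>\<close> again through \<open>decision_lr\<close>, but there only the rules of
  the agents before \<open>k\<close> matter.  Thresholds are extended reals, so that a negative threshold is
  possible.
\<close>

definition monotone_lr_tests ::
  "'a measure \<Rightarrow> nat \<Rightarrow> (nat \<Rightarrow> 'a \<Rightarrow> ennreal) \<Rightarrow> (nat \<Rightarrow> 'a \<Rightarrow> ennreal) \<Rightarrow>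
   (nat \<Rightarrow> ereal) \<Rightarrow> (nat \<Rightarrow> 'a \<Rightarrow> nat \<Rightarrow> nat) \<Rightarrow> bool" where
  "monotone_lr_tests \<mu> N q0 q1 t \<phi> \<longleftrightarrow>
     (\<forall>k \<in> {1..N}. \<forall>y \<in> space \<mu>. \<forall>u \<in> {0, 1}.
        \<phi> k y u =
          (if enn2ereal (q1 k y / q0 k y *
                decision_lr \<phi> (\<lambda>j. density \<mu> (q0 j)) (\<lambda>j. density \<mu> (q1 j)) (k - 1) u) > t k
           then 1 else 0))"

end

theory Submission
  imports Defs
begin

text \<open>
  For a single agent, every region that is upward closed in the least favorable likelihood ratio
  has maximal probability under \<open>Q0\<close> within its class, minimal probability under \<open>Q1\<close> within its
  class, and is at least as likely under \<open>Q1\<close> as under \<open>Q0\<close>. In the tandem, agent \<open>k\<close> decides 1 on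
  such a region, and the region only grows when the preceding decision changes from 0 to 1. Hence
  \<open>P(U\<^sub>k = 1)\<close> is a mixture of the probabilities of two nested regions, with weight \<open>P(U\<^sub>k\<^sub>-\<^sub>1 = 1)\<close>
  on the larger one, and the three inequalities propagate by induction on \<open>k\<close>.
\<close>

section \<open>Likelihood ratio of the least favorable densities\<close>

text \<open>Below \<open>c'\<close> both densities are multiples of \<open>p0\<close>, above
  \<open>c''\<close> both are multiples of \<open>p1\<close>, and in between each is its scaled
  nominal density; so the nominal ratio is clipped and rescaled. Points with
  \<open>p0 y = p1 y = 0\<close> have to be excluded: there the left side is 0 / 0 = 0, while the
  right side is a multiple of \<open>c'\<close>.\<close>

lemma lfd_density_ratio:
  fixes c' c'' :: ennreal
  assumes eps: "\<epsilon>0 < 1" "\<epsilon>1 < 1"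
    and c: "c' < c''"
    and y: "p0 y < \<infinity>" "p1 y < \<infinity>" "p0 y \<noteq> 0 \<or> p1 y \<noteq> 0"
  shows "lfd_density1 \<epsilon>1 c' p0 p1 y / lfd_density0 \<epsilon>0 c'' p0 p1 y =
    ennreal ((1 - \<epsilon>1) / (1 - \<epsilon>0)) * max c' (min (p1 y / p0 y) c'')"
proof -
  obtain a where a: "p0 y = ennreal a" "0 \<le> a" using y(1) by (cases "p0 y") auto
  obtain b where b: "p1 y = ennreal b" "0 \<le> b" using y(2) by (cases "p1 y") auto
  obtain d where d: "c' = ennreal d" "0 \<le> d" using c by (cases "c'") auto
  note [simp] = lfd_density0_def lfd_density1_def
  consider (low) "p1 y / p0 y \<le> c'" | (mid) "c' < p1 y / p0 y" "p1 y / p0 y < c''"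
    | (high) "c'' \<le> p1 y / p0 y" by fastforce
  then show ?thesis
  proof cases
    case low
    have "a > 0"
    proof (rule ccontr)
      assume "\<not> a > 0"
      then have "p1 y / p0 y = \<infinity>" using a b y(3) by simp
      then show False using low d by (simp add: top_unique)
    qed
    moreover have "p1 y / p0 y < c''" "\<not> c' < p1 y / p0 y"
      "max c' (min (p1 y / p0 y) c'') = c'"
      using low c by (auto simp: max_absorb1 min.coboundedI1)
    ultimately show ?thesis using a d eps
      by (simp del: not_less add: ennreal_mult[symmetric] divide_ennreal)
  next
    case mid
    have "a > 0"
    proof (rule ccontr)
      assume "\<not> a > 0"
      then have "p1 y / p0 y = \<infinity>" using a b y(3) by simp
      then show False using mid by simp
    qed
    then show ?thesis using mid a b d eps
      by (simp add: min_absorb1 max_absorb2 ennreal_mult[symmetric] divide_ennreal)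
  next
    case high
    \<comment> \<open>Both densities are multiples of \<open>p1 y\<close> here, so
      \<open>p0 y\<close> may be 0; positivity of \<open>p1 y\<close> keeps the quotient from being
      0 / 0.\<close>
    have "b > 0"
    proof (rule ccontr)
      assume "\<not> b > 0"
      then have "c'' \<le> 0" using high b by simp
      then show False using c by simp
    qed
    have l: "c' < p1 y / p0 y" "\<not> p1 y / p0 y < c''" "max c' (min (p1 y / p0 y) c'') = c''"
      using high c by (auto simp: max_absorb2 min_absorb2)
    show ?thesis
    proof (cases "c''")
      case (real r)
      then have "0 < r" using c d by (cases "r = 0") auto
      then show ?thesis using l b eps real \<open>b > 0\<close>
        by (simp del: not_less add: ennreal_mult[symmetric] divide_ennreal)
    next
      \<comment> \<open>Division by an infinite \<open>c''\<close> makes the density in the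
        denominator 0, so the quotient is infinite, as is the right side.\<close>
      case top
      then show ?thesis using l b eps \<open>b > 0\<close>
        by (simp del: not_less add: ennreal_mult[symmetric] ennreal_mult_top)
    qed
  qed
qed

section \<open>Contamination classes, and two densities compared on an upward closed set\<close>

lemma nominal_in_contamination_class:
  assumes "Pnom \<in> space (prob_algebra M)"
  shows "Pnom \<in> contamination_class M Pnom \<epsilon>"
  using assms unfolding contamination_class_def by (auto intro!: bexI[of _ Pnom] simp: algebra_simps)

text \<open>The contaminant \<open>R\<close> is dropped. The least favorable laws attain this bound
  on sets where their densities are the scaled nominal ones, which is the source of their
  extremality.\<close>

lemma contamination_class_ge:
  assumes "P \<in> contamination_class M Pnom \<epsilon>" "0 \<le> \<epsilon>" "A \<in> sets M"
  shows "(1 - \<epsilon>) * measure Pnom A \<le> measure P A"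
  using assms unfolding contamination_class_def by auto

lemma contamination_class_prob:
  assumes "P \<in> contamination_class M Pnom \<epsilon>"
  shows "prob_space P" "sets P = sets M" "space P = space M"
  using assms unfolding contamination_class_def space_prob_algebra
  by (auto dest: sets_eq_imp_space_eq)

text \<open>If the ratio is at least 1 on all of \<open>A\<close>, then \<open>q0 \<le> q1\<close>
  pointwise there. Otherwise some point of \<open>A\<close> has ratio below 1, and upward closure
  keeps every ratio outside \<open>A\<close> below that one; then the complements are compared, both
  laws having total mass 1.\<close>

lemma density_ratio_upset_mono:
  fixes q0 q1 :: "'a \<Rightarrow> ennreal"
  assumes q: "q0 \<in> borel_measurable \<mu>" "q1 \<in> borel_measurable \<mu>"
    and prob: "prob_space (density \<mu> q0)" "prob_space (density \<mu> q1)"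
    and A: "A \<in> sets \<mu>"
    and upset: "\<And>y y'. y \<in> A \<Longrightarrow> y' \<in> space \<mu> \<Longrightarrow> q1 y / q0 y \<le> q1 y' / q0 y' \<Longrightarrow> y' \<in> A"
  shows "measure (density \<mu> q0) A \<le> measure (density \<mu> q1) A"
proof -
  interpret Q0: prob_space "density \<mu> q0" by fact
  interpret Q1: prob_space "density \<mu> q1" by fact
  \<comment> \<open>Both pointwise bounds survive extreme values of \<open>q0\<close>: a quotient by
    0 is 0 or infinite, and a quotient by infinity is always 0.\<close>
  have ge: "q0 y \<le> q1 y" if "1 \<le> q1 y / q0 y" for y
  proof (cases "q0 y = 0 \<or> q0 y = \<infinity>")
    case True
    then show ?thesis using that by (auto simp: ennreal_divide_top)
  next
    case False
    have "1 * q0 y \<le> q1 y / q0 y * q0 y" using that by (rule mult_right_mono) simp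
    with False show ?thesis by (simp add: ennreal_divide_times ennreal_mult_divide_eq less_top)
  qed
  have le: "q1 y \<le> q0 y" if "q1 y / q0 y \<le> 1" for y
  proof (cases "q0 y = 0 \<or> q0 y = \<infinity>")
    case True
    then show ?thesis using that by (cases "q1 y = 0") (auto simp: top_unique)
  next
    case False
    have "q1 y / q0 y * q0 y \<le> 1 * q0 y" using that by (rule mult_right_mono) simp
    with False show ?thesis by (simp add: ennreal_divide_times ennreal_mult_divide_eq less_top)
  qed
  show ?thesis
  proof (cases "\<forall>y\<in>A. 1 \<le> q1 y / q0 y")
    case True
    have "emeasure (density \<mu> q0) A \<le> emeasure (density \<mu> q1) A"
      unfolding emeasure_density[OF q(1) A] emeasure_density[OF q(2) A]
      using True ge by (intro nn_integral_mono) (auto split: split_indicator)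
    then show ?thesis by (simp add: Q0.emeasure_eq_measure Q1.emeasure_eq_measure)
  next
    case False
    then obtain y where "y \<in> A" "q1 y / q0 y < 1" by (auto simp: not_le)
    then have *: "q1 y' / q0 y' \<le> 1" if "y' \<in> space \<mu> - A" for y'
      using upset[of y y'] that by (metis DiffD1 DiffD2 le_cases less_imp_le order.trans)
    have C: "space \<mu> - A \<in> sets \<mu>" using A by auto
    have "emeasure (density \<mu> q1) (space \<mu> - A) \<le> emeasure (density \<mu> q0) (space \<mu> - A)"
      unfolding emeasure_density[OF q(1) C] emeasure_density[OF q(2) C]
      using * le by (intro nn_integral_mono) (auto split: split_indicator)
    then have "measure (density \<mu> q1) (space \<mu> - A) \<le> measure (density \<mu> q0) (space \<mu> - A)"
      by (simp add: Q0.emeasure_eq_measure Q1.emeasure_eq_measure)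
    then show ?thesis using Q0.prob_compl[of A] Q1.prob_compl[of A] A by simp
  qed
qed

section \<open>Extremality of the least favorable pair for one agent\<close>

locale lfd_pair =
  fixes M \<mu> :: "'a measure" and p0 p1 :: "'a \<Rightarrow> ennreal"
    and \<epsilon>0 \<epsilon>1 :: real and c' c'' :: ennreal
  assumes dominating: "sets \<mu> = sets M"
    and p_measurable [measurable]: "p0 \<in> borel_measurable \<mu>" "p1 \<in> borel_measurable \<mu>"
    and nominal: "density \<mu> p0 \<in> space (prob_algebra M)" "density \<mu> p1 \<in> space (prob_algebra M)"
    and eps: "0 \<le> \<epsilon>0" "\<epsilon>0 < 1" "0 \<le> \<epsilon>1" "\<epsilon>1 < 1"
    and abs_cont: "mutually_absolutely_continuous
      (contamination_class M (density \<mu> p0) \<epsilon>0 \<union> contamination_class M (density \<mu> p1) \<epsilon>1)"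
    and lfd: "lfd_constants \<mu> p0 p1 \<epsilon>0 \<epsilon>1 c' c''"
begin

abbreviation "q0 \<equiv> lfd_density0 \<epsilon>0 c'' p0 p1"
abbreviation "q1 \<equiv> lfd_density1 \<epsilon>1 c' p0 p1"
abbreviation "lr y \<equiv> q1 y / q0 y"
abbreviation "class0 \<equiv> contamination_class M (density \<mu> p0) \<epsilon>0"
abbreviation "class1 \<equiv> contamination_class M (density \<mu> p1) \<epsilon>1"

text \<open>Outside this set \<open>lr\<close> is the clipped and rescaled nominal ratio. The set
  need not be null for \<open>\<mu>\<close>, which may charge points with
  \<open>p0 y = p1 y = 0\<close>, but it is null under every law of both classes.\<close>

definition "degenerate = {y \<in> space M. p0 y = \<infinity> \<or> p1 y = \<infinity> \<or> p0 y = 0 \<and> p1 y = 0}"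

lemma space_eq: "space \<mu> = space M"
  using dominating by (rule sets_eq_imp_space_eq)

lemma q_measurable [measurable]: "q0 \<in> borel_measurable \<mu>" "q1 \<in> borel_measurable \<mu>"
  unfolding lfd_density0_def lfd_density1_def by measurable

lemma prob_nominal: "prob_space (density \<mu> p0)" "prob_space (density \<mu> p1)"
  using nominal by (auto simp: space_prob_algebra)

lemma prob_lfd: "prob_space (density \<mu> q0)" "prob_space (density \<mu> q1)"
proof -
  have "(\<integral>\<^sup>+ y. q0 y \<partial>\<mu>) = 1" "(\<integral>\<^sup>+ y. q1 y \<partial>\<mu>) = 1"
    using lfd by (simp_all add: lfd_constants_def)
  then show "prob_space (density \<mu> q0)" "prob_space (density \<mu> q1)"
    by (auto intro!: prob_spaceI simp: emeasure_density cong: nn_integral_cong)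
qed

lemma lr_eq:
  assumes "y \<in> space M - degenerate"
  shows "lr y = ennreal ((1 - \<epsilon>1) / (1 - \<epsilon>0)) * max c' (min (p1 y / p0 y) c'')"
  using assms lfd eps
  by (intro lfd_density_ratio) (auto simp: degenerate_def lfd_constants_def less_top)

lemma sets_degenerate: "degenerate \<in> sets M"
proof -
  have "degenerate = {y \<in> space \<mu>. p0 y = \<infinity> \<or> p1 y = \<infinity> \<or> p0 y = 0 \<and> p1 y = 0}"
    by (simp add: degenerate_def space_eq)
  also have "\<dots> \<in> sets \<mu>" by measurable
  finally show ?thesis by (simp add: dominating)
qed

lemma AE_finite: "AE y in \<mu>. p0 y \<noteq> \<infinity> \<and> p1 y \<noteq> \<infinity>"
proof -
  have "(\<integral>\<^sup>+ y. p0 y \<partial>\<mu>) = 1" "(\<integral>\<^sup>+ y. p1 y \<partial>\<mu>) = 1"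
    using prob_nominal[THEN prob_space.emeasure_space_1]
    by (auto simp: emeasure_density cong: nn_integral_cong)
  then show ?thesis by (intro AE_conjI nn_integral_PInf_AE) auto
qed

lemma degenerate_null0: "degenerate \<in> null_sets (density \<mu> p0)"
proof -
  have "AE y in \<mu>. y \<in> degenerate \<longrightarrow> p0 y = 0"
    using AE_finite by eventually_elim (auto simp: degenerate_def)
  then show ?thesis using sets_degenerate by (auto simp: null_sets_density_iff dominating)
qed

lemma class_absolutely_continuous:
  assumes "P \<in> class0 \<union> class1" "P' \<in> class0 \<union> class1" "A \<in> sets M" "measure P A = 0"
  shows "measure P' A = 0"
proof -
  have "absolutely_continuous P P'"
    using abs_cont assms(1,2) by (auto simp: mutually_absolutely_continuous_def)
  moreover have "prob_space P" and "sets P = sets M"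
    using contamination_class_prob[of P M] assms(1) by blast+
  then have "A \<in> null_sets P"
    using assms(3,4)
    by (auto simp: null_sets_def finite_measure.emeasure_eq_measure prob_space.finite_measure)
  ultimately have "A \<in> null_sets P'" by (auto simp: absolutely_continuous_def)
  then show ?thesis by (auto simp: null_sets_def measure_def)
qed

text \<open>Contamination alone could put mass on these points. Mutual absolute continuity forbids
  it: the nominal law, a member of its own class, gives them none.\<close>

lemma degenerate_null:
  assumes "P \<in> class0 \<union> class1"
  shows "measure P degenerate = 0"
proof (rule class_absolutely_continuous[OF _ assms sets_degenerate])
  show "density \<mu> p0 \<in> class0 \<union> class1"
    using nominal_in_contamination_class[OF nominal(1)] by blast
  show "measure (density \<mu> p0) degenerate = 0"
    using degenerate_null0 by (auto simp: null_sets_def measure_def)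
qed

lemma measure_lfd0:
  assumes A: "A \<in> sets M" and less: "\<And>y. y \<in> A - degenerate \<Longrightarrow> p1 y / p0 y < c''"
  shows "measure (density \<mu> q0) A = (1 - \<epsilon>0) * measure (density \<mu> p0) A"
proof -
  have A': "A \<in> sets \<mu>" using A dominating by simp
  have "c'' > 0" using lfd by (auto simp: lfd_constants_def intro: le_less_trans)
  have "emeasure (density \<mu> q0) A = (\<integral>\<^sup>+ y. ennreal (1 - \<epsilon>0) * (p0 y * indicator A y) \<partial>\<mu>)"
    unfolding emeasure_density[OF q_measurable(1) A']
  proof (rule nn_integral_cong_AE)
    show "AE y in \<mu>. q0 y * indicator A y = ennreal (1 - \<epsilon>0) * (p0 y * indicator A y)"
      using AE_finite
    proof eventually_elim
      case (elim y)
      show ?case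
      proof (cases "y \<in> A")
        case True
        have "p1 y / p0 y < c''"
        proof (cases "y \<in> degenerate")
          \<comment> \<open>Finite densities leave only \<open>p0 y = p1 y = 0\<close>, and 0 / 0 =
            0 lies below \<open>c''\<close>.\<close>
          case d: True
          then show ?thesis using elim \<open>c'' > 0\<close> by (auto simp: degenerate_def)
        next
          case False
          then show ?thesis using less True by auto
        qed
        then show ?thesis by (simp add: lfd_density0_def mult.assoc)
      qed simp
    qed
  qed
  also have "\<dots> = ennreal (1 - \<epsilon>0) * emeasure (density \<mu> p0) A"
    using A' by (subst nn_integral_cmult) (auto simp: emeasure_density)
  finally show ?thesis using eps by (simp add: measure_def enn2real_mult)
qed

lemma measure_lfd1:
  assumes A: "A \<in> sets M" and greater: "\<And>y. y \<in> A - degenerate \<Longrightarrow> c' < p1 y / p0 y"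
  shows "measure (density \<mu> q1) A = (1 - \<epsilon>1) * measure (density \<mu> p1) A"
proof -
  have A': "A \<in> sets \<mu>" using A dominating by simp
  have "emeasure (density \<mu> q1) A = (\<integral>\<^sup>+ y. ennreal (1 - \<epsilon>1) * (p1 y * indicator A y) \<partial>\<mu>)"
    unfolding emeasure_density[OF q_measurable(2) A']
  proof (rule nn_integral_cong_AE)
    show "AE y in \<mu>. q1 y * indicator A y = ennreal (1 - \<epsilon>1) * (p1 y * indicator A y)"
      using AE_finite
    proof eventually_elim
      case (elim y)
      show ?case
      proof (cases "y \<in> A")
        case True
        show ?thesis
        proof (cases "y \<in> degenerate")
          \<comment> \<open>Finite densities leave only \<open>p0 y = p1 y = 0\<close>, where either
            branch of \<open>q1\<close> gives 0.\<close>
          case d: True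
          then show ?thesis using elim by (auto simp: degenerate_def lfd_density1_def)
        next
          case False
          then show ?thesis using greater True by (auto simp: lfd_density1_def mult.assoc)
        qed
      qed simp
    qed
  qed
  also have "\<dots> = ennreal (1 - \<epsilon>1) * emeasure (density \<mu> p1) A"
    using A' by (subst nn_integral_cmult) (auto simp: emeasure_density)
  finally show ?thesis using eps by (simp add: measure_def enn2real_mult)
qed

context
  fixes A
  assumes A: "A \<in> sets M"
    and upset: "\<And>y y'. y \<in> A \<Longrightarrow> y' \<in> space M \<Longrightarrow> lr y \<le> lr y' \<Longrightarrow> y' \<in> A"
begin

text \<open>
  The ratio \<open>lr\<close> attains its maximum wherever the nominal ratio is at least \<open>c''\<close>. So either \<open>A\<close> is
  null, or off \<open>A\<close> the density \<open>q0\<close> is \<open>1 - \<epsilon>0\<close> times the nominal one, which no member of the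
  class undercuts.
\<close>

lemma class0_le_lfd0:
  assumes P: "P \<in> class0"
  shows "measure P A \<le> measure (density \<mu> q0) A"
proof (cases "\<exists>y \<in> space M - degenerate - A. c'' \<le> p1 y / p0 y")
  case True
  then obtain y where y: "y \<in> space M - degenerate" "y \<notin> A" "c'' \<le> p1 y / p0 y" by auto
  have "A \<subseteq> degenerate"
  proof
    fix z assume z: "z \<in> A"
    show "z \<in> degenerate"
    proof (rule ccontr)
      assume "z \<notin> degenerate"
      with z A have z': "z \<in> space M - degenerate" using sets.sets_into_space by auto
      have "lr z \<le> lr y"
        unfolding lr_eq[OF z'] lr_eq[OF y(1)] using y(3)
        by (intro mult_left_mono max.mono) (auto simp: min_absorb2)
      then show False using upset[OF z] y by auto
    qed
  qed
  then have "measure P A \<le> measure P degenerate"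
    using contamination_class_prob[OF P] sets_degenerate A
    by (intro finite_measure.finite_measure_mono) (auto dest: prob_space.finite_measure)
  then show ?thesis using degenerate_null P by (simp add: order_trans[OF _ measure_nonneg])
next
  case False
  interpret P: prob_space P using contamination_class_prob[OF P] by simp
  interpret Q: prob_space "density \<mu> q0" by (rule prob_lfd)
  have C: "space M - A \<in> sets M" using A by auto
  have "measure (density \<mu> q0) (space M - A) = (1 - \<epsilon>0) * measure (density \<mu> p0) (space M - A)"
    using False by (intro measure_lfd0 C) (auto simp: not_le)
  also have "\<dots> \<le> measure P (space M - A)"
    using P eps C by (intro contamination_class_ge)
  finally show ?thesis
    using P.prob_compl[of A] Q.prob_compl[of A] A contamination_class_prob[OF P]
    by (simp add: space_eq dominating)
qed

text \<open>Dual to the bound for \<open>class0\<close>: off \<open>degenerate\<close>,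
  \<open>lr\<close> is minimal wherever the nominal ratio is at most \<open>c'\<close>. If
  \<open>A\<close> contains such a point, only degenerate points lie outside \<open>A\<close>, so
  \<open>P\<close> gives \<open>A\<close> mass 1. Otherwise \<open>q1\<close> is
  \<open>1 - \<epsilon>1\<close> times the nominal density almost everywhere on \<open>A\<close>,
  and no member of the class undercuts that.\<close>

lemma lfd1_le_class1:
  assumes P: "P \<in> class1"
  shows "measure (density \<mu> q1) A \<le> measure P A"
proof (cases "\<exists>y \<in> A - degenerate. p1 y / p0 y \<le> c'")
  case True
  interpret P: prob_space P using contamination_class_prob[OF P] by simp
  interpret Q: prob_space "density \<mu> q1" by (rule prob_lfd)
  obtain y where y: "y \<in> A" "y \<notin> degenerate" "p1 y / p0 y \<le> c'" using True by auto
  have y': "y \<in> space M - degenerate" using y A sets.sets_into_space by auto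
  have "space M - A \<subseteq> degenerate"
  proof
    fix z assume z: "z \<in> space M - A"
    show "z \<in> degenerate"
    proof (rule ccontr)
      assume "z \<notin> degenerate"
      with z have z': "z \<in> space M - degenerate" by auto
      have "max c' (min (p1 y / p0 y) c'') = c'"
        using y(3) by (simp add: max_absorb1 min.coboundedI1)
      then have "lr y \<le> lr z"
        unfolding lr_eq[OF z'] lr_eq[OF y'] by (simp add: mult_left_mono)
      then show False using upset[OF y(1)] z by auto
    qed
  qed
  then have "measure P (space M - A) \<le> measure P degenerate"
    using contamination_class_prob[OF P] sets_degenerate by (intro P.finite_measure_mono) auto
  then have "measure P A = 1"
    using degenerate_null P P.prob_compl[of A] A contamination_class_prob[OF P]
      P.prob_le_1[of A] by (intro antisym) auto
  then show ?thesis by simp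
next
  case False
  have "measure (density \<mu> q1) A = (1 - \<epsilon>1) * measure (density \<mu> p1) A"
    using False by (intro measure_lfd1 A) (auto simp: not_le)
  also have "\<dots> \<le> measure P A"
    using P eps A by (intro contamination_class_ge)
  finally show ?thesis .
qed

lemma lfd0_le_lfd1: "measure (density \<mu> q0) A \<le> measure (density \<mu> q1) A"
  using A upset prob_lfd by (intro density_ratio_upset_mono) (auto simp: dominating space_eq)

end

end

section \<open>Recursion for the decision probabilities along the tandem\<close>

lemma tandem_decision_upd:
  "k < i \<Longrightarrow> tandem_decision \<phi> k (x(i := y)) = tandem_decision \<phi> k x"
  by (induction k) auto

context
  fixes M :: "'a measure" and \<phi> :: "nat \<Rightarrow> 'a \<Rightarrow> nat \<Rightarrow> nat" and N :: nat and P :: "nat \<Rightarrow> 'a measure"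
  assumes prob: "\<And>k. k \<in> {1..N} \<Longrightarrow> prob_space (P k)"
    and sets_eq_M: "\<And>k. k \<in> {1..N} \<Longrightarrow> sets (P k) = sets M"
    and binary: "\<And>k y u. k \<in> {1..N} \<Longrightarrow> y \<in> space M \<Longrightarrow> u \<in> {0, 1} \<Longrightarrow> \<phi> k y u \<in> {0, 1}"
    and sets_\<phi>: "\<And>k u. k \<in> {1..N} \<Longrightarrow> u \<in> {0, 1} \<Longrightarrow> {y \<in> space M. \<phi> k y u = 1} \<in> sets M"
begin

lemma space_eq_M: "k \<in> {1..N} \<Longrightarrow> space (P k) = space M"
  using sets_eq_M by (rule sets_eq_imp_space_eq)

lemma prob_product_law: "k \<le> N \<Longrightarrow> prob_space (product_law k P)"
  unfolding product_law_def by (intro prob_space_PiM prob) auto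

lemma tandem_decision_binary:
  "k \<le> N \<Longrightarrow> y \<in> space (product_law k P) \<Longrightarrow> tandem_decision \<phi> k y \<in> {0, 1}"
proof (induction k arbitrary: y)
  case (Suc k)
  \<comment> \<open>Points of a product space are \<open>undefined\<close> outside the index set, so
    \<open>y\<close> is restricted before the induction hypothesis applies; decisions up to agent
    \<open>k\<close> do not see the difference.\<close>
  let ?y = "restrict y {1..k}"
  have "?y \<in> space (product_law k P)"
    using Suc.prems by (auto simp: product_law_def space_PiM PiE_iff)
  moreover have "tandem_decision \<phi> j ?y = tandem_decision \<phi> j y" if "j \<le> k" for j
    using that by (induction j) auto
  moreover have "y (Suc k) \<in> space M"
    using Suc.prems space_eq_M[of "Suc k"] by (auto simp: product_law_def space_PiM PiE_iff)
  ultimately show ?case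
    using Suc binary[of "Suc k" "y (Suc k)" "tandem_decision \<phi> k y"]
    by (metis Suc_leD atLeastAtMost_iff le_add1 order_refl plus_1_eq_Suc tandem_decision.simps(2))
qed simp

lemma sets_tandem_decision_1:
  "k \<le> N \<Longrightarrow> {y \<in> space (product_law k P). tandem_decision \<phi> k y = 1} \<in> sets (product_law k P)"
proof (induction k)
  case (Suc k)
  let ?S = "product_law (Suc k) P"
  let ?U = "{y \<in> space (product_law k P). tandem_decision \<phi> k y = 1}"
  let ?A = "\<lambda>u. {y \<in> space M. \<phi> (Suc k) y u = 1}"
  let ?r = "\<lambda>y. restrict y {1..k}"
  have r: "?r \<in> measurable ?S (product_law k P)"
    unfolding product_law_def by (intro measurable_restrict_subset) auto
  have c: "(\<lambda>y. y (Suc k)) \<in> measurable ?S M"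
    using measurable_component_singleton[of "Suc k" "{1..Suc k}" P] sets_eq_M[of "Suc k"] Suc.prems
    unfolding product_law_def by (simp cong: measurable_cong_sets)
  have td: "tandem_decision \<phi> j (?r y) = tandem_decision \<phi> j y" if "j \<le> k" for j y
    using that by (induction j) auto
  \<comment> \<open>The event is split by the decision of agent \<open>k\<close>; the complement of
    \<open>?U\<close> stands for decision 0 because decisions are binary.\<close>
  have "{y \<in> space ?S. tandem_decision \<phi> (Suc k) y = 1} =
      (?r -` ?U \<inter> space ?S) \<inter> ((\<lambda>y. y (Suc k)) -` ?A 1 \<inter> space ?S)
      \<union> (space ?S - (?r -` ?U \<inter> space ?S)) \<inter> ((\<lambda>y. y (Suc k)) -` ?A 0 \<inter> space ?S)"
  proof (intro set_eqI)
    fix y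
    show "y \<in> {y \<in> space ?S. tandem_decision \<phi> (Suc k) y = 1} \<longleftrightarrow> y \<in>
      (?r -` ?U \<inter> space ?S) \<inter> ((\<lambda>y. y (Suc k)) -` ?A 1 \<inter> space ?S)
      \<union> (space ?S - (?r -` ?U \<inter> space ?S)) \<inter> ((\<lambda>y. y (Suc k)) -` ?A 0 \<inter> space ?S)"
    proof (cases "y \<in> space ?S")
      case y: True
      have "?r y \<in> space (product_law k P)" "tandem_decision \<phi> k y \<in> {0, 1}" "y (Suc k) \<in> space M"
        using measurable_space[OF r y] measurable_space[OF c y] tandem_decision_binary[of k "?r y"]
          Suc.prems td[of k y] by auto
      then show ?thesis using y by (auto simp: td simp del: One_nat_def)
    qed simp
  qed
  also have "\<dots> \<in> sets ?S"
    using Suc.prems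
    by (intro sets.Un sets.Int[OF _ measurable_sets[OF c]] sets.compl_sets
        measurable_sets[OF r Suc.IH] sets_\<phi>) auto
  finally show ?case .
qed simp

lemma decision_prob_0:
  assumes "k \<le> N"
  shows "decision_prob \<phi> k P 0 = 1 - decision_prob \<phi> k P 1"
proof -
  interpret prob_space "product_law k P" using assms by (rule prob_product_law)
  have "{y \<in> space (product_law k P). tandem_decision \<phi> k y = 0} =
    space (product_law k P) - {y \<in> space (product_law k P). tandem_decision \<phi> k y = 1}"
    using tandem_decision_binary[OF assms] by auto
  then show ?thesis
    unfolding decision_prob_def using prob_compl[OF sets_tandem_decision_1[OF assms]] by simp
qed

text \<open>The last observation is independent of the preceding decision. By Fubini, integrating it
  out gives \<open>r u\<close> where \<open>u\<close> is that decision, and the remaining integral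
  weights \<open>r 1\<close> and \<open>r 0\<close> by the law of \<open>u\<close>.\<close>

lemma decision_prob_Suc:
  assumes k: "Suc k \<le> N"
  defines "r \<equiv> \<lambda>u. measure (P (Suc k)) {y \<in> space M. \<phi> (Suc k) y u = 1}"
  shows "decision_prob \<phi> (Suc k) P 1 =
    decision_prob \<phi> k P 1 * r 1 + (1 - decision_prob \<phi> k P 1) * r 0"
proof -
  \<comment> \<open>\<open>product_prob_space\<close> asks for a probability measure at every index,
    while \<open>P\<close> is known to be one only on \<open>{1..N}\<close>. Filling the other
    indices leaves the product laws up to \<open>N\<close> unchanged.\<close>
  let ?P' = "\<lambda>j. if j \<in> {1..N} then P j else P (Suc k)"
  interpret product_prob_space ?P' "{1..Suc k}"
    unfolding product_prob_space_def product_prob_space_axioms_def product_sigma_finite_def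
    using prob k by (auto intro: prob_space_imp_sigma_finite)
  interpret K: prob_space "product_law k P" using prob_product_law k by simp
  interpret S: prob_space "product_law (Suc k) P" using prob_product_law k by simp
  interpret C: prob_space "P (Suc k)" using prob k by simp
  have law: "product_law j P = PiM {1..j} ?P'" if "j \<le> N" for j
    unfolding product_law_def using that by (intro PiM_cong) auto
  have ins: "{1..Suc k} = insert (Suc k) {1..k}" by auto
  let ?U = "\<lambda>j. {y \<in> space (product_law j P). tandem_decision \<phi> j y = 1}"
  let ?A = "\<lambda>u. {y \<in> space M. \<phi> (Suc k) y u = 1}"
  have U: "?U (Suc k) \<in> sets (product_law (Suc k) P)" "?U k \<in> sets (product_law k P)"
    using k by (intro sets_tandem_decision_1; simp)+
  have A: "?A u \<in> sets (P (Suc k))" if "u \<in> {0, 1}" for u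
    using sets_\<phi>[of "Suc k", OF _ that] sets_eq_M[of "Suc k"] k by simp
  have "emeasure (product_law (Suc k) P) (?U (Suc k))
      = (\<integral>\<^sup>+ x. indicator (?U (Suc k)) x \<partial>product_law (Suc k) P)"
    using U by simp
  also have "\<dots> = (\<integral>\<^sup>+ x. \<integral>\<^sup>+ y. indicator (?U (Suc k)) (x(Suc k := y)) \<partial>P (Suc k) \<partial>product_law k P)"
  proof -
    define V where "V = ?U (Suc k)"
    have "V \<in> sets (PiM (insert (Suc k) {1..k}) ?P')"
      using U(1)[folded V_def] unfolding law[OF k] ins .
    then have "integral\<^sup>N (PiM (insert (Suc k) {1..k}) ?P') (indicator V) =
      (\<integral>\<^sup>+ x. \<integral>\<^sup>+ y. indicator V (x(Suc k := y)) \<partial>?P' (Suc k) \<partial>PiM {1..k} ?P')"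
      by (intro product_nn_integral_insert borel_measurable_indicator) auto
    then show ?thesis
      unfolding V_def[symmetric] unfolding law[OF k] law[OF Suc_leD[OF k]] ins using k by simp
  qed
  also have "\<dots> = (\<integral>\<^sup>+ x. ennreal (r 1) * indicator (?U k) x
      + ennreal (r 0) * indicator (space (product_law k P) - ?U k) x \<partial>product_law k P)"
  proof (rule nn_integral_cong)
    fix x assume x: "x \<in> space (product_law k P)"
    define u where "u = tandem_decision \<phi> k x"
    have u: "u \<in> {0, 1}" unfolding u_def using tandem_decision_binary x k by auto
    have "(\<integral>\<^sup>+ y. indicator (?U (Suc k)) (x(Suc k := y)) \<partial>P (Suc k))
        = (\<integral>\<^sup>+ y. indicator (?A u) y \<partial>P (Suc k))"
    proof (rule nn_integral_cong)
      fix y assume y: "y \<in> space (P (Suc k))"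
      have "x(Suc k := y) \<in> space (product_law (Suc k) P)"
        using x y by (auto simp: product_law_def space_PiM PiE_iff extensional_def)
      then show "indicator (?U (Suc k)) (x(Suc k := y)) = (indicator (?A u) y :: ennreal)"
        using y space_eq_M[of "Suc k"] k
        by (auto simp: u_def tandem_decision_upd split: split_indicator)
    qed
    also have "\<dots> = ennreal (r u)"
      using A[OF u] by (simp add: r_def C.emeasure_eq_measure)
    finally show "(\<integral>\<^sup>+ y. indicator (?U (Suc k)) (x(Suc k := y)) \<partial>P (Suc k)) =
      ennreal (r 1) * indicator (?U k) x
      + ennreal (r 0) * indicator (space (product_law k P) - ?U k) x"
      using u x by (auto simp: u_def)
  qed
  also have "\<dots> = ennreal (r 1) * emeasure (product_law k P) (?U k)
      + ennreal (r 0) * emeasure (product_law k P) (space (product_law k P) - ?U k)"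
    using U by (subst nn_integral_add) (auto simp: nn_integral_cmult)
  also have "\<dots> = ennreal (r 1 * decision_prob \<phi> k P 1 + r 0 * (1 - decision_prob \<phi> k P 1))"
    using K.prob_compl[OF U(2)]
    by (simp add: decision_prob_def K.emeasure_eq_measure r_def ennreal_mult[symmetric]
        ennreal_plus[symmetric] del: ennreal_plus)
  finally have "ennreal (decision_prob \<phi> (Suc k) P 1) =
    ennreal (r 1 * decision_prob \<phi> k P 1 + r 0 * (1 - decision_prob \<phi> k P 1))"
    unfolding decision_prob_def S.emeasure_eq_measure .
  moreover have "0 \<le> r 1 * decision_prob \<phi> k P 1 + r 0 * (1 - decision_prob \<phi> k P 1)"
    by (intro add_nonneg_nonneg mult_nonneg_nonneg) (simp_all add: r_def decision_prob_def)
  ultimately show ?thesis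
    by (subst (asm) ennreal_inj) (simp_all add: decision_prob_def mult.commute)
qed

lemma decision_prob_le_1: "k \<le> N \<Longrightarrow> decision_prob \<phi> k P 1 \<le> 1"
  unfolding decision_prob_def using prob_space.prob_le_1 prob_product_law by blast

end

section \<open>Real inequalities for the induction step\<close>

text \<open>Values and weight are raised one after the other, in either order, so an ordering of one
  of the two pairs of values suffices. The induction knows this ordering for the least favorable
  laws, which are the upper side against \<open>P0\<close> and the lower side against
  \<open>P1\<close>.\<close>

lemma mixture_mono:
  fixes x x' a b a' b' :: real
  assumes "x \<le> x'" "0 \<le> x" "x' \<le> 1" "a \<le> a'" "b \<le> b'" "b' \<le> a' \<or> b \<le> a \<or> x = x'"
  shows "x * a + (1 - x) * b \<le> x' * a' + (1 - x') * b'"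
proof -
  have *: "z * a + (1 - z) * b \<le> z * a' + (1 - z) * b'" if "0 \<le> z" "z \<le> 1" for z
    using that assms by (intro add_mono mult_left_mono) auto
  have "(x' - x) * (a' - b') \<ge> 0 \<or> (x' - x) * (a - b) \<ge> 0 \<or> x = x'"
    using assms by (auto intro: mult_nonneg_nonneg)
  then show ?thesis
    using *[of x] *[of x'] assms by (auto simp: algebra_simps)
qed

text \<open>Nonnegative summands vanish separately, and each vanishing factor is inherited. This
  passes nullity from \<open>P0\<close> to \<open>P1\<close> through the recursion for the decision
  probabilities.\<close>

lemma mixture_eq_0:
  fixes x y a b a' b' :: real
  assumes "0 \<le> x" "x \<le> 1" "0 \<le> a" "0 \<le> b"
    and "x = 0 \<Longrightarrow> y = 0" "x = 1 \<Longrightarrow> y = 1" "a = 0 \<Longrightarrow> a' = 0" "b = 0 \<Longrightarrow> b' = 0"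
    and "x * a + (1 - x) * b = 0"
  shows "y * a' + (1 - y) * b' = 0"
proof -
  have "x * a = 0" "(1 - x) * b = 0"
    using assms by (auto simp: add_nonneg_eq_0_iff)
  then show ?thesis using assms by auto
qed

text \<open>Away from the boundary, 1 separates the two quotients. For \<open>x = 0\<close> the
  right side is infinite since \<open>y \<noteq> 0\<close>; for \<open>x = 1\<close> the left side
  is 0 / 0 = 0. With \<open>x = y = 0\<close> the claim would read 1 \<le> 0 / 0 = 0.\<close>

lemma decision_ratio_le:
  fixes x y :: real
  assumes "0 \<le> x" "x \<le> y" "y \<le> 1" "y \<noteq> 0"
  shows "ennreal (1 - y) / ennreal (1 - x) \<le> ennreal y / ennreal x"
proof -
  consider "x = 0" | "x = 1" | "0 < x" "x < 1" using assms by linarith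
  then show ?thesis
  proof cases
    case 3
    then have "(1 - y) / (1 - x) \<le> 1" "1 \<le> y / x" using assms by auto
    then have "(1 - y) / (1 - x) \<le> y / x" by (rule order_trans)
    then show ?thesis using 3 assms by (simp add: divide_ennreal)
  qed (use assms in auto)
qed

section \<open>Induction along the tandem\<close>

theorem theorem1:
  fixes M \<mu> Pnom0 Pnom1 :: "'a measure"
    and p0 p1 :: "'a \<Rightarrow> ennreal"
    and \<epsilon>0 \<epsilon>1 :: "nat \<Rightarrow> real"
    and c' c'' :: "nat \<Rightarrow> ennreal"
    and q0 q1 :: "nat \<Rightarrow> 'a \<Rightarrow> ennreal"
    and Q0 Q1 P0 P1 :: "nat \<Rightarrow> 'a measure"
    and t :: "nat \<Rightarrow> ereal"
    and \<phi> :: "nat \<Rightarrow> 'a \<Rightarrow> nat \<Rightarrow> nat"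
    and N :: nat
  assumes N: "1 \<le> N"
    and nominal: "Pnom0 \<in> space (prob_algebra M)" "Pnom1 \<in> space (prob_algebra M)"
    and dominating: "sets \<mu> = sets M"
    and p_measurable: "p0 \<in> borel_measurable \<mu>" "p1 \<in> borel_measurable \<mu>"
    and p_density: "Pnom0 = density \<mu> p0" "Pnom1 = density \<mu> p1"
    and eps: "\<And>k. k \<in> {1..N} \<Longrightarrow> 0 \<le> \<epsilon>0 k \<and> \<epsilon>0 k < 1"
             "\<And>k. k \<in> {1..N} \<Longrightarrow> 0 \<le> \<epsilon>1 k \<and> \<epsilon>1 k < 1"
    and disjoint: "\<And>k. k \<in> {1..N} \<Longrightarrow>
          contamination_class M Pnom0 (\<epsilon>0 k) \<inter> contamination_class M Pnom1 (\<epsilon>1 k) = {}"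
    and abs_cont: "\<And>k. k \<in> {1..N} \<Longrightarrow>
          mutually_absolutely_continuous
            (contamination_class M Pnom0 (\<epsilon>0 k) \<union> contamination_class M Pnom1 (\<epsilon>1 k))"
    and lfd: "\<And>k. k \<in> {1..N} \<Longrightarrow> lfd_constants \<mu> p0 p1 (\<epsilon>0 k) (\<epsilon>1 k) (c' k) (c'' k)"
    and q_def: "q0 = (\<lambda>k. lfd_density0 (\<epsilon>0 k) (c'' k) p0 p1)"
               "q1 = (\<lambda>k. lfd_density1 (\<epsilon>1 k) (c' k) p0 p1)"
    and Q_def: "Q0 = (\<lambda>k. density \<mu> (q0 k))" "Q1 = (\<lambda>k. density \<mu> (q1 k))"
    and mlrt: "monotone_lr_tests \<mu> N q0 q1 t \<phi>"
    and P0: "P0 \<in> (\<Pi> k\<in>{1..N}. contamination_class M Pnom0 (\<epsilon>0 k))"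
    and P1: "P1 \<in> (\<Pi> k\<in>{1..N}. contamination_class M Pnom1 (\<epsilon>1 k))"
  shows "false_alarm_prob \<phi> N Q0 \<ge> false_alarm_prob \<phi> N P0 \<and>
         missed_detection_prob \<phi> N Q1 \<ge> missed_detection_prob \<phi> N P1"
proof -
  let ?A = "\<lambda>k u. {y \<in> space M. \<phi> k y u = 1}"
  let ?d = "\<lambda>k P. decision_prob \<phi> k P 1"
  let ?C = "\<lambda>k. contamination_class M Pnom0 (\<epsilon>0 k) \<union> contamination_class M Pnom1 (\<epsilon>1 k)"
  have space: "space \<mu> = space M" using dominating by (rule sets_eq_imp_space_eq)
  have pair: "lfd_pair M \<mu> p0 p1 (\<epsilon>0 k) (\<epsilon>1 k) (c' k) (c'' k)" if "k \<in> {1..N}" for k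
    using that dominating p_measurable nominal p_density eps abs_cont lfd
    by unfold_locales auto
  have \<phi>: "\<phi> k y u = (if enn2ereal (q1 k y / q0 k y * decision_lr \<phi> Q0 Q1 (k - 1) u) > t k
      then 1 else 0)" if "k \<in> {1..N}" "y \<in> space M" "u \<in> {0, 1}" for k y u
    using mlrt that unfolding monotone_lr_tests_def Q_def by (auto simp: space)
  have decide: "\<phi> k y u = 1 \<longleftrightarrow>
      t k < enn2ereal (q1 k y / q0 k y * decision_lr \<phi> Q0 Q1 (k - 1) u)"
    if "k \<in> {1..N}" "y \<in> space M" "u \<in> {0, 1}" for k y u
    using \<phi>[OF that] by auto
  have binary: "\<phi> k y u \<in> {0, 1}" if "k \<in> {1..N}" "y \<in> space M" "u \<in> {0, 1}" for k y u
    using \<phi>[OF that] by auto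
  have A: "?A k u \<in> sets M" if k: "k \<in> {1..N}" and u: "u \<in> {0, 1}" for k u
  proof -
    have [measurable]: "q0 k \<in> borel_measurable \<mu>" "q1 k \<in> borel_measurable \<mu>"
      using lfd_pair.q_measurable[OF pair[OF k]] by (simp_all add: q_def)
    have "?A k u = {y \<in> space \<mu>.
        enn2ereal (q1 k y / q0 k y * decision_lr \<phi> Q0 Q1 (k - 1) u) > t k}"
      unfolding space by (intro Collect_cong conj_cong refl decide k u)
    also have "\<dots> \<in> sets \<mu>" by measurable
    finally show ?thesis by (simp add: dominating)
  qed
  have upset: "y' \<in> ?A k u" if k: "k \<in> {1..N}" and u: "u \<in> {0, 1}" and y: "y \<in> ?A k u"
    and y': "y' \<in> space M" and le: "q1 k y / q0 k y \<le> q1 k y' / q0 k y'" for k u y y'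
  proof -
    have "t k < enn2ereal (q1 k y / q0 k y * decision_lr \<phi> Q0 Q1 (k - 1) u)"
      using y decide[OF k _ u, of y] by auto
    also have "\<dots> \<le> enn2ereal (q1 k y' / q0 k y' * decision_lr \<phi> Q0 Q1 (k - 1) u)"
      by (intro less_eq_ennreal.rep_eq[THEN iffD1] mult_right_mono le) simp
    finally show ?thesis using decide[OF k y' u] y' by simp
  qed
  have P0_le: "measure (P0 k) (?A k u) \<le> measure (Q0 k) (?A k u)"
    and Q1_le: "measure (Q1 k) (?A k u) \<le> measure (P1 k) (?A k u)"
    and Q_le: "measure (Q0 k) (?A k u) \<le> measure (Q1 k) (?A k u)"
    if k: "k \<in> {1..N}" and u: "u \<in> {0, 1}" for k u
  proof -
    note pair = pair[OF k]
    have up: "y' \<in> ?A k u" if "y \<in> ?A k u" "y' \<in> space M"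
      "lfd_density1 (\<epsilon>1 k) (c' k) p0 p1 y / lfd_density0 (\<epsilon>0 k) (c'' k) p0 p1 y
        \<le> lfd_density1 (\<epsilon>1 k) (c' k) p0 p1 y' / lfd_density0 (\<epsilon>0 k) (c'' k) p0 p1 y'" for y y'
      using upset[OF k u that(1,2)] that(3) by (simp only: q_def)
    have P: "P0 k \<in> contamination_class M (density \<mu> p0) (\<epsilon>0 k)"
      "P1 k \<in> contamination_class M (density \<mu> p1) (\<epsilon>1 k)"
      using P0 P1 k p_density by auto
    show "measure (P0 k) (?A k u) \<le> measure (Q0 k) (?A k u)"
      unfolding Q_def q_def by (rule lfd_pair.class0_le_lfd0[OF pair A[OF k u] up P(1)])
    show "measure (Q1 k) (?A k u) \<le> measure (P1 k) (?A k u)"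
      unfolding Q_def q_def by (rule lfd_pair.lfd1_le_class1[OF pair A[OF k u] up P(2)])
    show "measure (Q0 k) (?A k u) \<le> measure (Q1 k) (?A k u)"
      unfolding Q_def q_def by (rule lfd_pair.lfd0_le_lfd1[OF pair A[OF k u] up])
  qed
  have in_class: "P0 k \<in> ?C k" "P1 k \<in> ?C k" if "k \<in> {1..N}" for k
    using P0 P1 that by auto
  have laws: "prob_space (P k)" "sets (P k) = sets M" "space (P k) = space M"
    if "P \<in> {P0, P1, Q0, Q1}" "k \<in> {1..N}" for P k
    using that in_class[OF that(2)] lfd_pair.prob_lfd[OF pair[OF that(2)]]
    by (auto simp: Q_def q_def dominating space dest: contamination_class_prob)
  have null: "measure (P0 k) B = 0 \<Longrightarrow> measure (P1 k) B = 0" if "k \<in> {1..N}" "B \<in> sets M" for k B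
    using lfd_pair.class_absolutely_continuous[OF pair[OF that(1)] _ _ that(2)] in_class[OF that(1)]
    unfolding p_density by blast
  have full: "measure (P0 k) B = 1 \<Longrightarrow> measure (P1 k) B = 1" if "k \<in> {1..N}" "B \<in> sets M" for k B
  proof -
    have "measure (P0 k) (space M - B) = 1 - measure (P0 k) B"
      "measure (P1 k) (space M - B) = 1 - measure (P1 k) B"
      using prob_space.prob_compl[OF laws(1)[OF _ that(1)], of _ B] laws[OF _ that(1)] that(2)
      by auto
    then show "measure (P0 k) B = 1 \<Longrightarrow> measure (P1 k) B = 1"
      using null[OF that(1), of "space M - B"] that(2) by auto
  qed
  have step: "?d (Suc k) P =
      ?d k P * measure (P (Suc k)) (?A (Suc k) 1) + (1 - ?d k P) * measure (P (Suc k)) (?A (Suc k) 0)"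
    if "P \<in> {P0, P1, Q0, Q1}" "Suc k \<le> N" for P k
    by (rule decision_prob_Suc[OF laws(1,2)[OF that(1)] binary A that(2)])
  have le_1: "?d k P \<le> 1" if "P \<in> {P0, P1, Q0, Q1}" "k \<le> N" for P k
    by (rule decision_prob_le_1[OF laws(1,2)[OF that(1)] binary A that(2)])
  have compl: "decision_prob \<phi> k P 0 = 1 - ?d k P" if "P \<in> {P0, P1, Q0, Q1}" "k \<le> N" for P k
    by (rule decision_prob_0[OF laws(1,2)[OF that(1)] binary A that(2)])
  have nonneg: "0 \<le> ?d k P" for k P by (simp add: decision_prob_def)
  text \<open>
    The last two conjuncts cover a junk value: if \<open>U\<^sub>k = 1\<close> is null under both least favorable
    laws, its likelihood ratio is \<open>0 / 0 = 0\<close>, and the decision regions of the next agent may be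
    nested the wrong way. Then \<open>U\<^sub>k = 1\<close> has to be null under \<open>P1\<close> as well.
  \<close>
  have main: "?d k P0 \<le> ?d k Q0 \<and> ?d k Q1 \<le> ?d k P1 \<and> ?d k Q0 \<le> ?d k Q1 \<and>
      (?d k P0 = 0 \<longrightarrow> ?d k P1 = 0) \<and> (?d k P0 = 1 \<longrightarrow> ?d k P1 = 1)" if "k \<le> N" for k
    using that
  proof (induction k)
    \<comment> \<open>The initial decision is constantly 0, so all four probabilities are 0 and the
      last conjunct is vacuous.\<close>
    case 0
    then show ?case by (simp add: decision_prob_def)
  next
    case (Suc k)
    have k: "k \<le> N" "Suc k \<in> {1..N}" and kN: "Suc k \<le> N" using Suc.prems by auto
    note IH = Suc.IH[OF k(1)]
    have bounds: "?d k P0 \<le> 1" "?d k P1 \<le> 1" "?d k Q0 \<le> 1" "?d k Q1 \<le> 1"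
      using k(1) by (simp_all add: le_1 del: One_nat_def)
    let ?m = "\<lambda>P u. measure (P (Suc k)) (?A (Suc k) u)"
    note d = step[OF _ kN]
    have nested: "?m Q0 0 \<le> ?m Q0 1 \<and> ?m Q1 0 \<le> ?m Q1 1 \<or> ?d k Q0 = 0 \<and> ?d k Q1 = 0"
    proof (cases "?d k Q1 = 0")
      case True
      then show ?thesis using IH nonneg[of k Q0] by simp
    next
      case False
      \<comment> \<open>Here the comparison of \<open>Q0\<close> with \<open>Q1\<close> carried in
        the induction pays off: it makes decision 1 at least as strong evidence for the alternative
        as decision 0.\<close>
      have lr_mono: "decision_lr \<phi> Q0 Q1 k 0 \<le> decision_lr \<phi> Q0 Q1 k 1"
      proof (cases "k = 0")
        case False
        moreover have "decision_prob \<phi> k Q0 0 = 1 - ?d k Q0" "decision_prob \<phi> k Q1 0 = 1 - ?d k Q1"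
          using k(1) by (simp_all add: compl del: One_nat_def)
        ultimately show ?thesis
          using \<open>?d k Q1 \<noteq> 0\<close> IH bounds nonneg by (simp add: decision_lr_def decision_ratio_le)
      qed (simp add: decision_lr_def)
      have "?A (Suc k) 0 \<subseteq> ?A (Suc k) 1"
      proof
        fix y assume y: "y \<in> ?A (Suc k) 0"
        then have "t (Suc k) < enn2ereal (q1 (Suc k) y / q0 (Suc k) y * decision_lr \<phi> Q0 Q1 k 0)"
          using decide[OF k(2), of y 0] by simp
        also have "\<dots> \<le> enn2ereal (q1 (Suc k) y / q0 (Suc k) y * decision_lr \<phi> Q0 Q1 k 1)"
          by (intro less_eq_ennreal.rep_eq[THEN iffD1] mult_left_mono lr_mono) simp
        finally show "y \<in> ?A (Suc k) 1"
          using y decide[OF k(2), of y 1] by simp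
      qed
      then show ?thesis
        using laws[OF _ k(2)] A[OF k(2)]
        by (intro disjI1 conjI finite_measure.finite_measure_mono prob_space.finite_measure) auto
    qed
    \<comment> \<open>A zero under \<open>Q0\<close> forces a zero under \<open>P0\<close>, hence
      under \<open>P1\<close> by the carried implication. All weights then agree, which is the last
      alternative in \<open>mixture_mono\<close>.\<close>
    then have nested': "?m Q0 0 \<le> ?m Q0 1 \<and> ?m Q1 0 \<le> ?m Q1 1 \<or>
        ?d k P0 = 0 \<and> ?d k P1 = 0 \<and> ?d k Q0 = 0 \<and> ?d k Q1 = 0"
      using IH nonneg[of k P0] by auto
    have m: "?m P0 u \<le> ?m Q0 u" "?m Q1 u \<le> ?m P1 u" "?m Q0 u \<le> ?m Q1 u"
      "?m P0 u \<le> 1" "?m P0 u = 0 \<Longrightarrow> ?m P1 u = 0" "1 - ?m P0 u = 0 \<Longrightarrow> 1 - ?m P1 u = 0"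
      if "u \<in> {0, 1}" for u
      using P0_le[OF k(2) that] Q1_le[OF k(2) that] Q_le[OF k(2) that]
        prob_space.prob_le_1[OF laws(1)[of P0, OF _ k(2)]] null[OF k(2) A[OF k(2) that]]
        full[OF k(2) A[OF k(2) that]] by auto
    have "?d (Suc k) P0 \<le> ?d (Suc k) Q0"
      using IH nonneg bounds m nested' by (simp only: d insert_iff simp_thms) (intro mixture_mono; auto)
    moreover have "?d (Suc k) Q1 \<le> ?d (Suc k) P1"
      using IH nonneg bounds m nested' by (simp only: d insert_iff simp_thms) (intro mixture_mono; auto)
    moreover have "?d (Suc k) Q0 \<le> ?d (Suc k) Q1"
      using IH nonneg bounds m nested' by (simp only: d insert_iff simp_thms) (intro mixture_mono; auto)
    moreover have "?d (Suc k) P1 = 0" if "?d (Suc k) P0 = 0"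
    proof -
      have "?d k P1 * ?m P1 1 + (1 - ?d k P1) * ?m P1 0 = 0"
        by (rule mixture_eq_0[of "?d k P0" "?m P0 1" "?m P0 0"])
          (use IH nonneg bounds m d[of P0] that in auto)
      then show ?thesis using d[of P1] by simp
    qed
    \<comment> \<open>The same argument for the probabilities of deciding 0. Both implications are
      carried because \<open>mixture_eq_0\<close> has to treat either weight, \<open>x\<close> or
      \<open>1 - x\<close>, becoming 0.\<close>
    moreover have "?d (Suc k) P1 = 1" if "?d (Suc k) P0 = 1"
    proof -
      have "?d k P1 * (1 - ?m P1 1) + (1 - ?d k P1) * (1 - ?m P1 0) = 0"
        by (rule mixture_eq_0[of "?d k P0" "1 - ?m P0 1" "1 - ?m P0 0"])
          (use IH nonneg bounds m d[of P0] that in \<open>auto simp: algebra_simps\<close>)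
      then show ?thesis using d[of P1] by (simp add: algebra_simps)
    qed
    ultimately show ?case by blast
  qed
  \<comment> \<open>Complements turn the lower bound on deciding 1 under \<open>P1\<close> into the
    upper bound on missed detection.\<close>
  have "decision_prob \<phi> N Q1 0 = 1 - ?d N Q1" "decision_prob \<phi> N P1 0 = 1 - ?d N P1"
    by (simp_all add: compl del: One_nat_def)
  then show ?thesis
    using main[of N] by (simp add: false_alarm_prob_def missed_detection_prob_def)
qed

end
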